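(* Let $\lambda=(\underbrace{1,\dots,1}_{k},0,\dots,0)\in\mathbb{Z}^{n-1}$ with $k\le n-1$ and let $B=(1+\varepsilon)\cdot f^*_\lambda(s,t)$ for some $\varepsilon>0$. Then the cardinality of the minimal complete set $P^{NSP}_{min}(s,t)$ of UNSSPP$(G,\lambda)$ is intractable, i.e. it might be exponential in the number of vertices: there is a family of instances, consisting of directed graphs $G=(V,A)$ with arbitrarily large number $n=|V|$ of vertices, arc costs $c:A\to\mathbb{Z}_+$, vertices $s\ne t$, an integer $k\le n-1$ (part of the instance) and $\varepsilon>0$, on which $|P^{NSP}_{min}(s,t)|$ grows exponentially in $n$.
   Context: $\mathbb{Z}_+$ denotes the nonnegative integers; directed graphs may have parallel arcs, and paths are distinguished by their arcs. $\mathcal{P}_{st}$ is the set of all simple directed $s$-$t$-paths in $G$; $l(P)\le n-1$ is the number of arcs of $P$. For a path $P$, $c_{(i)}(P)$ is the $i$-th largest arc cost on $P$ for $1\le i\le l(P)$, and $c_{(i)}(P)=0$ for $l(P)<i\le n-1$. $f_\lambda(P)=\sum_{i=1}^{n-1}\lambda_ic_{(i)}(P)$ and $f^*_\lambda(s,t)=\min_{P\in\mathcal{P}_{st}}f_\lambda(P)$. UNSSPP$(G,\lambda)$ asks to enumerate $P^{NSP}(s,t)=\{P\in\mathcal{P}_{st}: f_\lambda(P)\le B\}$. Two paths $P_1,P_2\in\mathcal{P}_{st}$ are equivalent iff $f_\lambda(P_1)=f_\lambda(P_2)$. A minimal complete set $P^{NSP}_{min}(s,t)\subseteq P^{NSP}(s,t)$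 is a set such that every $P\in P^{NSP}(s,t)\setminus P^{NSP}_{min}(s,t)$ is equivalent to exactly one $P'\in P^{NSP}_{min}(s,t)$; being minimal, it contains exactly one representative of each equivalence class of $P^{NSP}(s,t)$. *)

theory Defs
  imports Complex_Main "Graph_Theory.Arc_Walk"
begin

text \<open>A path is the list of its arcs, so paths that differ only in the choice between
  parallel arcs are different. Weight vectors \<open>w\<close> stand for \<open>\<lambda>\<close> and are indexed from 1,
  only the entries \<open>1, \<dots>, n - 1\<close> being used.\<close>

definition simple_paths :: "('v, 'e) pre_digraph \<Rightarrow> 'v \<Rightarrow> 'v \<Rightarrow> 'e list set" where
  "simple_paths G s t = {P. pre_digraph.apath G s P t}"

definition sorted_cost :: "('e \<Rightarrow> nat) \<Rightarrow> nat \<Rightarrow> 'e list \<Rightarrow> nat" where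
  "sorted_cost c i P =
     (if 1 \<le> i \<and> i \<le> length P then rev (sort (map c P)) ! (i - 1) else 0)"

definition univ_cost ::
    "('v, 'e) pre_digraph \<Rightarrow> ('e \<Rightarrow> nat) \<Rightarrow> (nat \<Rightarrow> int) \<Rightarrow> 'e list \<Rightarrow> int" where
  "univ_cost G c w P = (\<Sum>i = 1..card (verts G) - 1. w i * int (sorted_cost c i P))"

text \<open>Unspecified if there is no \<open>s\<close>-\<open>t\<close>-path.\<close>

definition opt_cost ::
    "('v, 'e) pre_digraph \<Rightarrow> ('e \<Rightarrow> nat) \<Rightarrow> (nat \<Rightarrow> int) \<Rightarrow> 'v \<Rightarrow> 'v \<Rightarrow> int" where
  "opt_cost G c w s t = Min (univ_cost G c w ` simple_paths G s t)"

definition near_paths ::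
    "('v, 'e) pre_digraph \<Rightarrow> ('e \<Rightarrow> nat) \<Rightarrow> (nat \<Rightarrow> int) \<Rightarrow> 'v \<Rightarrow> 'v \<Rightarrow> real \<Rightarrow> 'e list set" where
  "near_paths G c w s t B = {P \<in> simple_paths G s t. real_of_int (univ_cost G c w P) \<le> B}"

definition path_equiv ::
    "('v, 'e) pre_digraph \<Rightarrow> ('e \<Rightarrow> nat) \<Rightarrow> (nat \<Rightarrow> int) \<Rightarrow> 'e list \<Rightarrow> 'e list \<Rightarrow> bool" where
  "path_equiv G c w P Q \<longleftrightarrow> univ_cost G c w P = univ_cost G c w Q"

definition complete_set ::
    "('v, 'e) pre_digraph \<Rightarrow> ('e \<Rightarrow> nat) \<Rightarrow> (nat \<Rightarrow> int) \<Rightarrow> 'v \<Rightarrow> 'v \<Rightarrow> real \<Rightarrow> 'e list set \<Rightarrow> bool" where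
  "complete_set G c w s t B M \<longleftrightarrow>
     M \<subseteq> near_paths G c w s t B \<and>
     (\<forall>P \<in> near_paths G c w s t B - M. \<exists>!P'. P' \<in> M \<and> path_equiv G c w P P')"

definition minimal_complete_set ::
    "('v, 'e) pre_digraph \<Rightarrow> ('e \<Rightarrow> nat) \<Rightarrow> (nat \<Rightarrow> int) \<Rightarrow> 'v \<Rightarrow> 'v \<Rightarrow> real \<Rightarrow> 'e list set \<Rightarrow> bool" where
  "minimal_complete_set G c w s t B M \<longleftrightarrow>
     complete_set G c w s t B M \<and> \<not> (\<exists>M'. M' \<subset> M \<and> complete_set G c w s t B M')"

text \<open>Minimality with respect to inclusion means exactly one representative per
  equivalence class.\<close>

lemma minimal_complete_set_iff:
  "minimal_complete_set G c w s t B M \<longleftrightarrow>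
     M \<subseteq> near_paths G c w s t B \<and>
     (\<forall>P \<in> near_paths G c w s t B. \<exists>!P'. P' \<in> M \<and> path_equiv G c w P P')"
    (is "?L \<longleftrightarrow> ?R")
proof
  assume L: ?L
  then have com: "complete_set G c w s t B M"
    by (simp add: minimal_complete_set_def)
  have uniq: "P = Q" if P: "P \<in> M" and Q: "Q \<in> M" and PQ: "path_equiv G c w P Q" for P Q
  proof (rule ccontr)
    assume ne: "P \<noteq> Q"
    define M' where "M' = M - {R. R \<noteq> P \<and> path_equiv G c w P R}"
    have "M' \<subset> M"
      using Q PQ ne by (auto simp: M'_def)
    moreover have "complete_set G c w s t B M'"
      unfolding complete_set_def
    proof (intro conjI ballI)
      show "M' \<subseteq> near_paths G c w s t B"
        using com by (auto simp: M'_def complete_set_def)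
    next
      fix R assume R: "R \<in> near_paths G c w s t B - M'"
      show "\<exists>!P'. P' \<in> M' \<and> path_equiv G c w R P'"
      proof (cases "path_equiv G c w P R")
        case True
        then show ?thesis
          using P by (intro ex1I[of _ P]) (auto simp: M'_def path_equiv_def)
      next
        case False
        then have "R \<notin> M"
          using R by (auto simp: M'_def)
        then have "\<exists>!P'. P' \<in> M \<and> path_equiv G c w R P'"
          using R com by (auto simp: complete_set_def)
        moreover have "P' \<in> M' \<longleftrightarrow> P' \<in> M" if "path_equiv G c w R P'" for P'
          using that False by (auto simp: M'_def path_equiv_def)
        ultimately show ?thesis
          by metis
      qed
    qed
    ultimately show False
      using L by (auto simp: minimal_complete_set_def)
  qed
  show ?R
  proof (intro conjI ballI)
    show "M \<subseteq> near_paths G c w s t B"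
      using com by (simp add: complete_set_def)
  next
    fix P assume P: "P \<in> near_paths G c w s t B"
    show "\<exists>!P'. P' \<in> M \<and> path_equiv G c w P P'"
    proof (cases "P \<in> M")
      case True
      then show ?thesis
        using uniq by (intro ex1I[of _ P]) (auto simp: path_equiv_def)
    next
      case False
      then show ?thesis
        using P com by (simp add: complete_set_def)
    qed
  qed
next
  assume R: ?R
  have no_smaller: "False" if sub: "M' \<subset> M" and com: "complete_set G c w s t B M'" for M'
  proof -
    obtain P where P: "P \<in> M" "P \<notin> M'"
      using sub by blast
    then have near: "P \<in> near_paths G c w s t B"
      using R by blast
    then obtain P' where P': "P' \<in> M'" "path_equiv G c w P P'"
      using com P(2) unfolding complete_set_def by blast
    have "path_equiv G c w P P"
      by (simp add: path_equiv_def)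
    moreover have "P' \<in> M"
      using P'(1) sub by blast
    ultimately have "P = P'"
      using R near P(1) P'(2) by blast
    then show False
      using P(2) P'(1) by simp
  qed
  have "complete_set G c w s t B M"
    using R by (simp add: complete_set_def)
  then show ?L
    unfolding minimal_complete_set_def using no_smaller by blast
qed

definition top_k :: "nat \<Rightarrow> nat \<Rightarrow> int" where
  "top_k k i = (if 1 \<le> i \<and> i \<le> k then 1 else 0)"

end

theory Submission
  imports Defs "HOL-Library.Multiset"
begin

text \<open>Take the vertices \<open>0, \<dots>, m\<close> and join \<open>i\<close> to \<open>i + 1\<close> by two parallel arcs, of costs
  \<open>2\<^sup>i\<close> and \<open>2 \<sqdot> 2\<^sup>i\<close>. With \<open>k = m = n - 1\<close> the universal cost is the ordinary path length,
  and by binary expansion the \<open>0\<close>-\<open>m\<close>-paths realise all \<open>2\<^sup>m\<close> lengths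
  \<open>(2\<^sup>m - 1) + x\<close> with \<open>x < 2\<^sup>m\<close>. Since all of them are at most twice the optimum
  \<open>2\<^sup>m - 1\<close>, the choice \<open>\<epsilon> = 1\<close> makes every path feasible.\<close>

section \<open>Minimal complete sets and cost values\<close>

lemma minimal_complete_set_image:
  assumes "minimal_complete_set G c w s t B M"
  shows "univ_cost G c w ` M = univ_cost G c w ` near_paths G c w s t B"
proof
  show "univ_cost G c w ` M \<subseteq> univ_cost G c w ` near_paths G c w s t B"
    using assms by (intro image_mono) (simp add: minimal_complete_set_iff)
  show "univ_cost G c w ` near_paths G c w s t B \<subseteq> univ_cost G c w ` M"
  proof (rule image_subsetI)
    fix P assume "P \<in> near_paths G c w s t B"
    with assms have "\<exists>!P'. P' \<in> M \<and> path_equiv G c w P P'"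
      by (simp add: minimal_complete_set_iff)
    then obtain P' where "P' \<in> M" "univ_cost G c w P = univ_cost G c w P'"
      unfolding path_equiv_def by (elim ex1E conjE)
    then show "univ_cost G c w P \<in> univ_cost G c w ` M"
      by simp
  qed
qed

text \<open>Choosing one feasible path per cost value gives such a set. This keeps the bound over
  all \<open>M\<close> in the theorem from being vacuous.\<close>

lemma minimal_complete_set_exists: "\<exists>M. minimal_complete_set G c w s t B M"
proof -
  let ?f = "univ_cost G c w" and ?N = "near_paths G c w s t B"
  obtain M where M: "M \<subseteq> ?N" "inj_on ?f M" "?f ` ?N = ?f ` M"
    using subset_image_inj[THEN iffD1, OF subset_refl[of "?f ` ?N"]] by metis
  have unique: "\<exists>!P'. P' \<in> M \<and> ?f P = ?f P'" if "P \<in> ?N" for P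
  proof -
    have "?f P \<in> ?f ` M"
      using that M(3) by blast
    then show ?thesis
      using M(2) by (auto simp: inj_on_def)
  qed
  show ?thesis
    unfolding minimal_complete_set_iff path_equiv_def
    by (intro exI[of _ M] conjI ballI M(1) unique)
qed

section \<open>Universal cost with all weights equal to one\<close>

lemma sum_sorted_cost:
  assumes "length P \<le> l"
  shows "(\<Sum>i = 1..l. sorted_cost c i P) = sum_list (map c P)"
proof -
  \<comment> \<open>Positions beyond the length of \<open>P\<close> carry the default cost 0. What
    remains is a permutation of the arc costs.\<close>
  have "(\<Sum>i = 1..l. sorted_cost c i P) = (\<Sum>i = 1..length P. sorted_cost c i P)"
    using assms by (intro sum.mono_neutral_right) (auto simp: sorted_cost_def)
  also have "\<dots> = (\<Sum>i = 0..<length P. sorted_cost c (Suc i) P)"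
    by (simp add: sum.atLeast_Suc_atMost_Suc_shift sum.atLeast1_atMost_eq atLeast0LessThan)
  also have "\<dots> = (\<Sum>i = 0..<length P. rev (sort (map c P)) ! i)"
    by (intro sum.cong) (auto simp: sorted_cost_def)
  also have "\<dots> = sum_list (rev (sort (map c P)))"
    by (simp add: sum_list_sum_nth)
  also have "\<dots> = sum_list (map c P)"
    by (metis mset_rev mset_sort sum_mset_sum_list)
  finally show ?thesis .
qed

lemma univ_cost_top_k_all:
  assumes "length P \<le> card (verts G) - 1"
  shows "univ_cost G c (top_k (card (verts G) - 1)) P = int (sum_list (map c P))"
proof -
  have "univ_cost G c (top_k (card (verts G) - 1)) P
      = (\<Sum>i = 1..card (verts G) - 1. int (sorted_cost c i P))"
    unfolding univ_cost_def by (intro sum.cong) (auto simp: top_k_def)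
  then show ?thesis
    using sum_sorted_cost[OF assms, of c] by (simp only: of_nat_sum[symmetric])
qed

section \<open>The doubled path and its simple paths\<close>

definition double_path :: "nat \<Rightarrow> (nat, nat) pre_digraph" where
  "double_path m =
     \<lparr>verts = {..m}, arcs = {..<2 * m}, tail = \<lambda>e. e div 2, head = \<lambda>e. Suc (e div 2)\<rparr>"

text \<open>Arcs \<open>2 * i\<close> and \<open>2 * i + 1\<close> form the parallel pair from
  \<open>i\<close> to \<open>i + 1\<close>: \<open>e div 2\<close> is the position of an arc, and
  \<open>e mod 2\<close> tells the cheap arc from the expensive one.\<close>

definition binary_cost :: "nat \<Rightarrow> nat" where
  "binary_cost e = (1 + e mod 2) * 2 ^ (e div 2)"

lemma double_path_simps [simp]:
  "verts (double_path m) = {..m}"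
  "arcs (double_path m) = {..<2 * m}"
  "tail (double_path m) e = e div 2"
  "head (double_path m) e = Suc (e div 2)"
  by (simp_all add: double_path_def)

lemma fin_digraph_double_path: "fin_digraph (double_path m)"
  by unfold_locales auto

lemma Cons_eq_upt_iff: "x # xs = [u..<v] \<longleftrightarrow> u < v \<and> x = u \<and> xs = [Suc u..<v]"
  by (cases "u < v") (auto simp: upt_conv_Cons)

text \<open>Every arc raises the vertex by exactly one, so the only freedom of a walk is the parity
  of the arc at each position.\<close>

lemma awalk_double_path_iff:
  "pre_digraph.awalk (double_path m) u p v \<longleftrightarrow>
     u \<le> v \<and> v \<le> m \<and> map (\<lambda>e. e div 2) p = [u..<v]"
proof -
  interpret fin_digraph "double_path m"
    by (rule fin_digraph_double_path)
  show ?thesis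
  proof (induction p arbitrary: u)
    case Nil
    have "[] = [u..<v] \<longleftrightarrow> v \<le> u"
      by (cases "u < v") (auto simp: upt_conv_Cons)
    then show ?case
      by (auto simp: awalk_Nil_iff)
  next
    case (Cons e p)
    show ?case
      by (auto simp: awalk_Cons_iff Cons.IH upt_conv_Cons Cons_eq_upt_iff)
  qed
qed

text \<open>The visited vertices are distinct, so every walk is already a simple path.\<close>

lemma awalk_verts_double_path:
  assumes "u \<le> v" "map (\<lambda>e. e div 2) p = [u..<v]"
  shows "pre_digraph.awalk_verts (double_path m) u p = [u..<Suc v]"
  using assms
proof (induction p arbitrary: u)
  case Nil
  then have "u = v"
    using upt_eq_Nil_conv[of u v] by auto
  then show ?case
    by (simp add: pre_digraph.awalk_verts.simps)
next
  case (Cons e p)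
  then show ?case
    by (auto simp: pre_digraph.awalk_verts.simps upt_conv_Cons Cons_eq_upt_iff
        simp del: upt_Suc)
qed

lemma simple_paths_double_path:
  "simple_paths (double_path m) 0 m = {p. map (\<lambda>e. e div 2) p = [0..<m]}"
  unfolding simple_paths_def pre_digraph.apath_def awalk_double_path_iff
  by (auto simp: awalk_verts_double_path simp del: upt_Suc)

lemma finite_simple_paths_double_path: "finite (simple_paths (double_path m) 0 m)"
  unfolding simple_paths_def
  by (rule fin_digraph.apaths_finite[OF fin_digraph_double_path])

section \<open>Path costs and binary digits\<close>

lemma sum_list_pow2: "sum_list (map ((^) (2::nat)) [0..<m]) = 2 ^ m - 1"
  by (induction m) auto

text \<open>The arc at position \<open>i\<close> costs once or twice \<open>2 ^ i\<close>, so the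
  total lies between the geometric sum and its double.\<close>

lemma binary_cost_bounds:
  assumes "map (\<lambda>e. e div 2) p = [0..<m]"
  shows "2 ^ m - 1 \<le> sum_list (map binary_cost p)"
    and "sum_list (map binary_cost p) \<le> 2 * (2 ^ m - 1)"
proof -
  have *: "(\<Sum>e\<leftarrow>p. 2 ^ (e div 2)) = (2 ^ m - 1 :: nat)"
    unfolding sum_list_pow2[of m, folded assms, symmetric] by (simp add: o_def)
  show "2 ^ m - 1 \<le> sum_list (map binary_cost p)"
    unfolding *[symmetric] by (intro sum_list_mono) (auto simp: binary_cost_def)
  have "sum_list (map binary_cost p) \<le> (\<Sum>e\<leftarrow>p. 2 * 2 ^ (e div 2))"
    by (intro sum_list_mono) (auto simp: binary_cost_def)
  then show "sum_list (map binary_cost p) \<le> 2 * (2 ^ m - 1)"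
    by (simp add: sum_list_const_mult *)
qed

definition digit_path :: "nat \<Rightarrow> nat \<Rightarrow> nat list" where
  "digit_path m x = map (\<lambda>i. 2 * i + x div 2 ^ i mod 2) [0..<m]"

lemma map_digit_path: "map (\<lambda>e. e div 2) (digit_path m x) = [0..<m]"
  by (simp add: digit_path_def o_def map_idI)

text \<open>The cheap arcs alone cost \<open>2 ^ m - 1\<close>, and a digit 1 at position
  \<open>i\<close> adds \<open>2 ^ i\<close>. The path reads only the lowest \<open>m\<close> digits
  of \<open>x\<close>; stating this with \<open>mod\<close> lets the induction keep \<open>x\<close>
  arbitrary.\<close>

lemma cost_digit_path:
  "sum_list (map binary_cost (digit_path m x)) = (2 ^ m - 1) + x mod 2 ^ m"
proof (induction m)
  case 0
  then show ?case
    by (simp add: digit_path_def)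
next
  case (Suc m)
  \<comment> \<open>Split off digit \<open>m\<close>, which selects the last arc.\<close>
  have "x mod 2 ^ Suc m = 2 ^ m * (x div 2 ^ m mod 2) + x mod 2 ^ m"
    by (metis mod_mult2_eq power_Suc2)
  moreover have "sum_list (map binary_cost (digit_path (Suc m) x))
      = sum_list (map binary_cost (digit_path m x)) + (2 ^ m + 2 ^ m * (x div 2 ^ m mod 2))"
    by (simp add: digit_path_def binary_cost_def)
  moreover have "(2 :: nat) ^ m - 1 + 2 ^ m = 2 ^ Suc m - 1"
    by simp
  ultimately show ?case
    unfolding Suc by linarith
qed

section \<open>Counting costs and exponential growth\<close>

lemma card_minimal_complete_set_double_path:
  fixes m :: nat
  defines "G \<equiv> double_path m" and "w \<equiv> top_k m"
  assumes M: "minimal_complete_set G binary_cost w 0 m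
    ((1 + 1) * real_of_int (opt_cost G binary_cost w 0 m)) M"
  shows "2 ^ m \<le> card M"
proof -
  let ?S = "simple_paths G 0 m" and ?f = "univ_cost G binary_cost w"
  let ?B = "(1 + 1) * real_of_int (opt_cost G binary_cost w 0 m)"
  have cost: "?f p = int (sum_list (map binary_cost p))" if "p \<in> ?S" for p
  proof -
    have "length p = m"
      using that map_eq_imp_length_eq[of "\<lambda>e. e div 2" p id "[0..<m]"]
      by (simp add: G_def simple_paths_double_path)
    then show ?thesis
      using univ_cost_top_k_all[of p G binary_cost] by (simp add: G_def w_def)
  qed
  have digit: "digit_path m x \<in> ?S" for x
    by (simp add: G_def simple_paths_double_path map_digit_path)
  have fin: "finite ?S"
    by (simp add: G_def finite_simple_paths_double_path)
  \<comment> \<open>The minimum is attained by some path, so the lower bound for path costs passes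
    to the optimum; feasibility of all paths needs no more.\<close>
  have "opt_cost G binary_cost w 0 m \<in> ?f ` ?S"
    unfolding opt_cost_def using fin digit by (intro Min_in) auto
  then have opt: "opt_cost G binary_cost w 0 m \<ge> int (2 ^ m - 1)"
  proof
    fix p
    assume "opt_cost G binary_cost w 0 m = ?f p" and p: "p \<in> ?S"
    then show ?thesis
      using binary_cost_bounds(1)[of p m]
      by (simp only: cost of_nat_le_iff) (simp add: G_def simple_paths_double_path)
  qed
  have "real_of_int (?f p) \<le> ?B" if "p \<in> ?S" for p
  proof -
    have "?f p \<le> int (2 * (2 ^ m - 1))"
      using cost[OF that] binary_cost_bounds(2)[of p m] that
      by (simp only: of_nat_le_iff) (simp add: G_def simple_paths_double_path)
    with opt have "?f p \<le> 2 * opt_cost G binary_cost w 0 m"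
      by linarith
    then have "real_of_int (?f p) \<le> real_of_int (2 * opt_cost G binary_cost w 0 m)"
      by (simp only: of_int_le_iff)
    then show ?thesis
      by simp
  qed
  then have near: "near_paths G binary_cost w 0 m ?B = ?S"
    by (auto simp: near_paths_def)
  have "(\<lambda>x. int (2 ^ m - 1 + x)) ` {..<2 ^ m} \<subseteq> ?f ` ?S"
  proof
    fix y assume "y \<in> (\<lambda>x. int (2 ^ m - 1 + x)) ` {..<2 ^ m}"
    then obtain x where "x < 2 ^ m" "y = int (2 ^ m - 1 + x)"
      by blast
    then have "y = ?f (digit_path m x)"
      by (simp add: cost[OF digit] cost_digit_path)
    then show "y \<in> ?f ` ?S"
      using digit by blast
  qed
  then have "card ((\<lambda>x. int (2 ^ m - 1 + x)) ` {..<2 ^ m :: nat}) \<le> card (?f ` ?S)"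
    using fin by (intro card_mono) auto
  moreover have "card ((\<lambda>x. int (2 ^ m - 1 + x)) ` {..<2 ^ m :: nat}) = 2 ^ m"
    by (subst card_image) (auto simp: inj_on_def)
  \<comment> \<open>Hence \<open>M\<close> has at least as many elements as there are distinct path
    costs.\<close>
  moreover have "?f ` M = ?f ` ?S"
    using minimal_complete_set_image[OF M] near by simp
  \<comment> \<open>An infinite set would have \<open>card\<close> 0, so finiteness is required
    before comparing \<open>M\<close> with its image.\<close>
  moreover have "finite M"
    using M near fin by (auto simp: minimal_complete_set_iff intro: finite_subset)
  ultimately show ?thesis
    by (metis card_image_le order_trans)
qed

text \<open>With n vertices there are only \<open>2 ^ (n - 1)\<close> costs, so base 2 is too large;
  base \<open>sqrt 2\<close> works because n \<le> 2(n - 1) for n \<ge> 2.\<close>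

lemma sqrt2_power_le: "sqrt 2 ^ Suc (Suc j) \<le> 2 ^ Suc j"
proof -
  have "sqrt 2 ^ Suc (Suc j) \<le> sqrt 2 ^ (2 * Suc j)"
    by (intro power_increasing) auto
  also have "\<dots> = 2 ^ Suc j"
    by (simp only: power_mult) simp
  finally show ?thesis .
qed

theorem corollary4p6:
  shows "\<exists>(\<alpha> :: real) > 1.
    \<exists>(G :: nat \<Rightarrow> (nat, nat) pre_digraph) (c :: nat \<Rightarrow> nat \<Rightarrow> nat)
      (s :: nat \<Rightarrow> nat) (t :: nat \<Rightarrow> nat) (k :: nat \<Rightarrow> nat) (\<epsilon> :: nat \<Rightarrow> real).
      filterlim (\<lambda>j. card (verts (G j))) at_top sequentially \<and>
      (\<forall>j. fin_digraph (G j) \<and>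
           s j \<in> verts (G j) \<and> t j \<in> verts (G j) \<and> s j \<noteq> t j \<and>
           simple_paths (G j) (s j) (t j) \<noteq> {} \<and>
           k j \<le> card (verts (G j)) - 1 \<and> \<epsilon> j > 0 \<and>
           (let w = top_k (k j);
                B = (1 + \<epsilon> j) * real_of_int (opt_cost (G j) (c j) w (s j) (t j))
            in (\<exists>M. minimal_complete_set (G j) (c j) w (s j) (t j) B M) \<and>
               (\<forall>M. minimal_complete_set (G j) (c j) w (s j) (t j) B M \<longrightarrow>
                    real (card M) \<ge> \<alpha> ^ card (verts (G j)))))"
proof (rule exI[of _ "sqrt 2"], rule conjI, simp, rule exI[of _ "\<lambda>j. double_path (Suc j)"],
    rule exI[of _ "\<lambda>_. binary_cost"], rule exI[of _ "\<lambda>_. 0"], rule exI[of _ Suc],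
    rule exI[of _ Suc], rule exI[of _ "\<lambda>_. 1"], intro conjI allI)
  \<comment> \<open>Instance \<open>j\<close> has m = \<open>Suc j\<close>, hence j + 2 vertices;
    the shift excludes m = 0, where source and target would coincide.\<close>
  show "filterlim (\<lambda>j. card (verts (double_path (Suc j)))) at_top sequentially"
    by (simp add: filterlim_at_top eventually_sequentially) (meson le_Suc_eq order_trans)
next
  fix j
  show "fin_digraph (double_path (Suc j))"
    by (rule fin_digraph_double_path)
  show "simple_paths (double_path (Suc j)) 0 (Suc j) \<noteq> {}"
    unfolding simple_paths_double_path using map_digit_path by blast
  have bound: "sqrt 2 ^ card (verts (double_path (Suc j))) \<le> real (card M)"
    if "minimal_complete_set (double_path (Suc j)) binary_cost (top_k (Suc j)) 0 (Suc j)
      ((1 + 1) * real_of_int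
        (opt_cost (double_path (Suc j)) binary_cost (top_k (Suc j)) 0 (Suc j))) M" for M
  proof -
    have "real (2 ^ Suc j) \<le> real (card M)"
      using card_minimal_complete_set_double_path[OF that] by (simp only: of_nat_le_iff)
    then show ?thesis
      using sqrt2_power_le[of j] by simp
  qed
  show "let w = top_k (Suc j);
      B = (1 + 1) * real_of_int (opt_cost (double_path (Suc j)) binary_cost w 0 (Suc j))
    in (\<exists>M. minimal_complete_set (double_path (Suc j)) binary_cost w 0 (Suc j) B M) \<and>
       (\<forall>M. minimal_complete_set (double_path (Suc j)) binary_cost w 0 (Suc j) B M \<longrightarrow>
          real (card M) \<ge> sqrt 2 ^ card (verts (double_path (Suc j))))"
    unfolding Let_def by (intro conjI allI impI minimal_complete_set_exists) (rule bound)
qed simp_all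

end
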